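(* Let $n\ge1$, $w\in\mathbb{R}^n_{>0}$, $1/2\le\beta<1$, $r_0>0$, $c_0,x^*\in\mathbb{R}^n$ with $x^*\in\mathcal{B}(c_0,r_0w)$, $R_k=\beta^kr_0$, and let $0\le\theta\le2\beta-1$, $\Delta=2\beta-1-\theta$. Let $s_k\in\{-1,+1\}^n$ be a sequence of signs, $c_{k+1}=c_k-(1-\beta)R_k\,w\odot s_k$, and suppose that for each $k$ the chosen sign is correct in every coordinate $i$ with $$|u_{k,i}|>\theta M_k+\eta_k,\qquad\text{where }u_{k,i}=\frac{c_{k,i}-x^*_i}{w_i},\quad M_k=\max_i|u_{k,i}|,\quad \eta_k\ge0 .$$ If $\eta_k\le\Delta R_k$ at each step, then $x^*\in\mathcal{B}(c_k,R_kw)$ and $M_k\le R_k$ for all $k\ge0$, for every such sequence of oracle answers.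
   Context: $\mathcal{B}(c,r)=\{x:|x_i-c_i|\le r_i\ \forall i\}$; $\odot$ is the componentwise product. The sign $s_{k,i}$ is correct when $s_{k,i}=\operatorname{sign}(c_{k,i}-x_i^* )$, i.e. the centre moves towards the target in coordinate $i$. In coordinates not satisfying the displayed inequality, $s_{k,i}\in\{-1,+1\}$ is arbitrary. *)

theory Defs
  imports "HOL-Analysis.Analysis"
begin

definition wbox :: "real ^ 'n \<Rightarrow> real ^ 'n \<Rightarrow> (real ^ 'n) set" where
  "wbox c r = {x. \<forall>i. \<bar>x $ i - c $ i\<bar> \<le> r $ i}"

end

theory Submission
  imports Defs
begin

text \<open>
  In the scaled coordinates \<open>u\<^sub>k\<close> the claim is that every \<open>\<bar>u\<^sub>k\<^sub>,\<^sub>i\<bar>\<close> is at most \<open>R\<^sub>k\<close>, and one step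
  moves every coordinate by exactly \<open>(1 - \<beta>) R\<^sub>k\<close>, so the coordinates can be treated separately.
  A step towards the target always lands within \<open>\<beta> R\<^sub>k = R\<^sub>k\<^sub>+\<^sub>1\<close>: the distance either shrinks by
  \<open>(1 - \<beta>) R\<^sub>k\<close>, or the target is overshot by at most \<open>(1 - \<beta>) R\<^sub>k \<le> \<beta> R\<^sub>k\<close>. A step away from the
  target is harmless as long as the coordinate has slack, that is
  \<open>\<bar>u\<^sub>k\<^sub>,\<^sub>i\<bar> \<le> \<beta> R\<^sub>k - (1 - \<beta>) R\<^sub>k = (2 \<beta> - 1) R\<^sub>k\<close>. The hypotheses on \<open>\<theta>\<close> and \<open>\<eta>\<close> ensure that only
  such coordinates may carry a wrong sign: if \<open>M\<^sub>k \<le> R\<^sub>k\<close>, then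
  \<open>\<theta> M\<^sub>k + \<eta>\<^sub>k \<le> \<theta> R\<^sub>k + \<Delta> R\<^sub>k = (2 \<beta> - 1) R\<^sub>k\<close>. The invariant therefore propagates by induction.
\<close>

text \<open>
  The number \<open>(2 * \<beta> - 1) * \<rho>\<close> is the largest distance from which a step of length \<open>(1 - \<beta>) * \<rho>\<close> in the
  wrong direction still ends within \<open>\<beta> * \<rho>\<close>. The bound \<open>1/2 \<le> \<beta>\<close> makes it nonnegative, and it
  also keeps an overshoot after a correct step within \<open>\<beta> * \<rho>\<close>.
\<close>

lemma sign_step_contracts:
  fixes v \<sigma> \<beta> \<rho> :: real
  assumes "1/2 \<le> \<beta>" "\<beta> \<le> 1" "\<bar>v\<bar> \<le> \<rho>" "\<bar>\<sigma>\<bar> = 1"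
    and correct: "(2 * \<beta> - 1) * \<rho> < \<bar>v\<bar> \<Longrightarrow> \<sigma> = sgn v"
  shows "\<bar>v - (1 - \<beta>) * \<rho> * \<sigma>\<bar> \<le> \<beta> * \<rho>"
proof (cases "(2 * \<beta> - 1) * \<rho> < \<bar>v\<bar>")
  case True
  have threshold_nonneg: "0 \<le> (2 * \<beta> - 1) * \<rho>"
    using assms by (intro mult_nonneg_nonneg) auto
  \<comment> \<open>Hence \<open>v\<close> is nonzero and the step changes \<open>\<bar>v\<bar>\<close> to \<open>\<bar>\<bar>v\<bar> - (1 - \<beta>) * \<rho>\<bar>\<close>.\<close>
  have "\<sigma> = 1 \<and> 0 < v \<or> \<sigma> = -1 \<and> v < 0"
    using correct[OF True] True threshold_nonneg by (auto simp: sgn_real_def)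
  moreover have "(1 - \<beta>) * \<rho> \<le> \<beta> * \<rho>" "v - (1 - \<beta>) * \<rho> \<le> \<beta> * \<rho>" "- v - (1 - \<beta>) * \<rho> \<le> \<beta> * \<rho>"
    using \<open>\<bar>v\<bar> \<le> \<rho>\<close> threshold_nonneg by (simp_all add: left_diff_distrib)
  ultimately show ?thesis
    by (elim disjE conjE) (simp_all only: abs_le_iff, linarith+)
next
  case False
  have "\<bar>v - (1 - \<beta>) * \<rho> * \<sigma>\<bar> \<le> \<bar>v\<bar> + \<bar>(1 - \<beta>) * \<rho> * \<sigma>\<bar>"
    by (rule abs_triangle_ineq4)
  also have "\<dots> = \<bar>v\<bar> + (1 - \<beta>) * \<rho>"
    using assms by (simp add: abs_mult)
  also have "\<dots> \<le> \<beta> * \<rho>"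
    using False by (simp add: algebra_simps)
  finally show ?thesis .
qed

lemma mem_wbox_scaleR_iff:
  fixes c w x :: "real ^ 'n"
  assumes "\<And>i. 0 < w $ i"
  shows "x \<in> wbox c (r *\<^sub>R w) \<longleftrightarrow> (\<forall>i. \<bar>(c $ i - x $ i) / w $ i\<bar> \<le> r)"
  using assms by (simp add: wbox_def abs_minus_commute pos_divide_le_eq abs_of_pos)

theorem theorem5p5:
  fixes w xstar :: "real ^ 'n"
    and \<beta> r0 \<theta> \<Delta> :: real
    and R M \<eta> :: "nat \<Rightarrow> real"
    and c s u :: "nat \<Rightarrow> real ^ 'n"
  assumes w_pos: "\<And>i. 0 < w $ i"
    and beta: "1/2 \<le> \<beta>" "\<beta> < 1"
    and r0_pos: "0 < r0"
    and init: "xstar \<in> wbox (c 0) (r0 *\<^sub>R w)"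
    and R_eq: "\<And>k. R k = \<beta> ^ k * r0"
    and theta: "0 \<le> \<theta>" "\<theta> \<le> 2 * \<beta> - 1"
    and Delta_eq: "\<Delta> = 2 * \<beta> - 1 - \<theta>"
    and signs: "\<And>k i. s k $ i \<in> {-1, 1}"
    and step: "\<And>k. c (Suc k) = c k - ((1 - \<beta>) * R k) *\<^sub>R (w * s k)"
    and u_eq: "\<And>k i. u k $ i = (c k $ i - xstar $ i) / w $ i"
    and M_eq: "\<And>k. M k = Max (range (\<lambda>i. \<bar>u k $ i\<bar>))"
    and eta_nonneg: "\<And>k. 0 \<le> \<eta> k"
    and correct: "\<And>k i. \<bar>u k $ i\<bar> > \<theta> * M k + \<eta> k \<Longrightarrow> s k $ i = sgn (c k $ i - xstar $ i)"
    and eta_le: "\<And>k. \<eta> k \<le> \<Delta> * R k"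
  shows "\<forall>k. xstar \<in> wbox (c k) (R k *\<^sub>R w) \<and> M k \<le> R k"
proof -
  have M_le_iff: "M k \<le> \<rho> \<longleftrightarrow> (\<forall>i. \<bar>u k $ i\<bar> \<le> \<rho>)" for k \<rho>
    unfolding M_eq by (subst Max_le_iff) auto
  have box_iff: "xstar \<in> wbox (c k) (\<rho> *\<^sub>R w) \<longleftrightarrow> (\<forall>i. \<bar>u k $ i\<bar> \<le> \<rho>)" for k \<rho>
    unfolding u_eq by (rule mem_wbox_scaleR_iff[OF w_pos])
  have u_step: "u (Suc k) $ i = u k $ i - (1 - \<beta>) * R k * s k $ i" for k i
    using w_pos[of i] by (simp add: u_eq step field_simps)
  have sgn_u: "sgn (c k $ i - xstar $ i) = sgn (u k $ i)" for k i
    using w_pos[of i] by (simp add: u_eq sgn_divide)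
  have "\<forall>i. \<bar>u k $ i\<bar> \<le> R k" for k
  proof (induction k)
    case 0
    show ?case
      using init by (simp add: box_iff R_eq)
  next
    case (Suc k)
    have "\<theta> * M k + \<eta> k \<le> \<theta> * R k + \<Delta> * R k"
      using Suc M_le_iff theta(1) eta_le by (intro add_mono mult_left_mono) auto
    also have "\<dots> = (2 * \<beta> - 1) * R k"
      by (simp add: Delta_eq algebra_simps)
    finally have threshold: "\<theta> * M k + \<eta> k \<le> (2 * \<beta> - 1) * R k" .
    show ?case
    proof
      fix i
      have "\<bar>u k $ i - (1 - \<beta>) * R k * s k $ i\<bar> \<le> \<beta> * R k"
      proof (rule sign_step_contracts)
        show "\<bar>s k $ i\<bar> = 1"
          using signs[of k i] by auto
        show "s k $ i = sgn (u k $ i)" if "(2 * \<beta> - 1) * R k < \<bar>u k $ i\<bar>"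
          using correct[of k i] threshold that by (simp add: sgn_u)
      qed (use beta Suc in auto)
      then show "\<bar>u (Suc k) $ i\<bar> \<le> R (Suc k)"
        by (simp add: u_step R_eq mult.assoc)
    qed
  qed
  then show ?thesis
    by (simp add: box_iff M_le_iff)
qed

end
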